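(* Let $V : \mathrm{Hol}(\mathbb{H}) \to \mathrm{Hol}(\mathbb{H})$ be a linear operator such that for all $F \in \mathrm{Hol}(\mathbb{H})$ and all $r \in [0,1)$, $$\sup_{z \in L_r} |(VF)(z)| = \sup_{z \in L_r} |F(z)|.$$ Then there exist $\alpha, \beta \in \mathbb{T}$ such that $$V = C_{\tau^{-1}} \circ T_{\alpha,\beta} \circ C_\tau.$$
   Context: $\mathbb{D}$ is the open unit disc and $\mathbb{T}$ the unit circle of $\mathbb{C}$. $\mathbb{H} = \{z \in \mathbb{C} : \mathrm{Re}\, z > 0\}$ is the half-plane that is the image of $\mathbb{D}$ under the Cayley transform $\tau : \mathbb{D} \to \mathbb{H}$, $\tau(z) = \frac{1+z}{1-z}$, which is biholomorphic. For a domain $\Omega$, $\mathrm{Hol}(\Omega)$ is the space of holomorphic functions $\Omega \to \mathbb{C}$. For $r \in [0,1)$, $K_r = r\overline{\mathbb{D}} = \{z : |z| \le r\}$ and $L_r = \tau(K_r)$. $C_\tau : \mathrm{Hol}(\mathbb{H}) \to \mathrm{Hol}(\mathbb{D})$ and $C_{\tau^{-1}} : \mathrm{Hol}(\mathbb{D}) \to \mathrm{Hol}(\mathbb{H})$ are the composition operators $C_\tau F = F \circ \tau$ and $C_{\tau^{-1}} f = f \circ \tau^{-1}$. $T_{\alpha,\beta} : \mathrm{Hol}(\mathbb{D}) \to \mathrm{Hol}(\mathbb{D})$ is defined by $T_{\alpha,\beta}(f)(z) = \alpha f(\beta z)$. *)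

theory Defs
  imports "HOL-Complex_Analysis.Complex_Analysis"
begin

abbreviation unit_disc :: "complex set" where
  "unit_disc \<equiv> ball 0 1"

abbreviation unit_circle :: "complex set" where
  "unit_circle \<equiv> sphere 0 1"

definition right_half_plane :: "complex set" where
  "right_half_plane = {z. Re z > 0}"

text \<open>
  A function on a domain is encoded as a total function that is zero off the domain. In this way
  equality of elements of \<open>Hol \<Omega>\<close> is equality of functions on \<open>\<Omega>\<close>, and \<open>Hol \<Omega>\<close> is closed under
  the pointwise vector space operations.
\<close>

definition zero_off :: "complex set \<Rightarrow> (complex \<Rightarrow> complex) \<Rightarrow> complex \<Rightarrow> complex" where
  "zero_off \<Omega> f = (\<lambda>z. if z \<in> \<Omega> then f z else 0)"

definition Hol :: "complex set \<Rightarrow> (complex \<Rightarrow> complex) set" where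
  "Hol \<Omega> = {f. f holomorphic_on \<Omega> \<and> (\<forall>z. z \<notin> \<Omega> \<longrightarrow> f z = 0)}"

definition linear_operator_on ::
  "(complex \<Rightarrow> complex) set \<Rightarrow> ((complex \<Rightarrow> complex) \<Rightarrow> (complex \<Rightarrow> complex)) \<Rightarrow> bool" where
  "linear_operator_on X V \<longleftrightarrow>
     (\<forall>F\<in>X. V F \<in> X) \<and>
     (\<forall>F\<in>X. \<forall>G\<in>X. V (\<lambda>z. F z + G z) = (\<lambda>z. V F z + V G z)) \<and>
     (\<forall>c. \<forall>F\<in>X. V (\<lambda>z. c * F z) = (\<lambda>z. c * V F z))"

definition cayley :: "complex \<Rightarrow> complex" where
  "cayley z = (1 + z) / (1 - z)"

abbreviation cayley_inv :: "complex \<Rightarrow> complex" where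
  "cayley_inv \<equiv> inv_into unit_disc cayley"

definition L :: "real \<Rightarrow> complex set" where
  "L r = cayley ` cball 0 r"

definition C_cayley :: "(complex \<Rightarrow> complex) \<Rightarrow> (complex \<Rightarrow> complex)" where
  "C_cayley F = zero_off unit_disc (F \<circ> cayley)"

definition C_cayley_inv :: "(complex \<Rightarrow> complex) \<Rightarrow> (complex \<Rightarrow> complex)" where
  "C_cayley_inv f = zero_off right_half_plane (f \<circ> cayley_inv)"

definition T_op :: "complex \<Rightarrow> complex \<Rightarrow> (complex \<Rightarrow> complex) \<Rightarrow> (complex \<Rightarrow> complex)" where
  "T_op \<alpha> \<beta> f = zero_off unit_disc (\<lambda>z. \<alpha> * f (\<beta> * z))"

lemma Re_cayley_pos:
  assumes "z \<in> unit_disc" shows "cayley z \<in> right_half_plane"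
proof -
  have ne: "1 - z \<noteq> 0" using assms by auto
  have "(cmod z)\<^sup>2 < 1" using assms by (simp add: power_less_one_iff abs_square_less_1)
  then have "(Re z)\<^sup>2 + (Im z)\<^sup>2 < 1" by (simp add: cmod_power2)
  moreover have "(1 - Re z)\<^sup>2 + (Im z)\<^sup>2 > 0"
    using ne by (metis cmod_power2 minus_complex.simps one_complex.simps(1,2) zero_less_norm_iff
        zero_less_power diff_0 power2_minus)
  ultimately show ?thesis
    by (simp add: cayley_def right_half_plane_def Re_divide power2_eq_square algebra_simps)
qed

lemma cayley_inverse_mem:
  assumes "w \<in> right_half_plane"
  shows "(w - 1) / (w + 1) \<in> unit_disc" "cayley ((w - 1) / (w + 1)) = w"
proof -
  have re: "Re w > 0" using assms by (simp add: right_half_plane_def)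
  then have ne: "w + 1 \<noteq> 0" by (metis add_less_same_cancel2 less_numeral_extra(1) not_less_iff_gr_or_eq
        plus_complex.simps(1) one_complex.simps(1) zero_complex.simps(1) add_pos_pos)
  have "(cmod (w - 1))\<^sup>2 < (cmod (w + 1))\<^sup>2"
    unfolding cmod_power2 using re by (simp add: power2_eq_square algebra_simps)
  then have "cmod (w - 1) < cmod (w + 1)" by (rule power2_less_imp_less) simp
  then show "(w - 1) / (w + 1) \<in> unit_disc" using ne by (simp add: norm_divide)
  have "1 + (w - 1) / (w + 1) = 2 * w / (w + 1)" "1 - (w - 1) / (w + 1) = 2 / (w + 1)"
    using ne by (simp_all add: field_simps)
  then show "cayley ((w - 1) / (w + 1)) = w" using ne by (simp add: cayley_def)
qed

lemma bij_betw_cayley: "bij_betw cayley unit_disc right_half_plane"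
proof (rule bij_betw_imageI)
  show "inj_on cayley unit_disc"
  proof (rule inj_onI)
    fix x y assume "x \<in> unit_disc" "y \<in> unit_disc" and eq: "cayley x = cayley y"
    then have "1 - x \<noteq> 0" "1 - y \<noteq> 0" by auto
    with eq have "(1 + x) * (1 - y) = (1 + y) * (1 - x)"
      by (simp add: cayley_def frac_eq_eq)
    then have "2 * x = 2 * y" by (simp add: algebra_simps)
    then show "x = y" by simp
  qed
  show "cayley ` unit_disc = right_half_plane"
    using Re_cayley_pos cayley_inverse_mem by (metis image_eqI image_subsetI subsetI subset_antisym)
qed

lemma cayley_inv_eq:
  assumes "w \<in> right_half_plane" shows "cayley_inv w = (w - 1) / (w + 1)"
  using cayley_inverse_mem[OF assms] bij_betw_cayley
  by (metis bij_betw_imp_inj_on inv_into_f_eq)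

end

(* Conjugating by the Cayley transform gives a linear T on Hol(D) preserving every maximum modulus
   M_r. As M_r(T z^n) = r^n for all r, a Schwarz-type argument gives T z^n = c_n z^n with |c_n| = 1.
   The maximum modulus of T(1 + z + z^n) on |z| <= r is 1 + r + r^n; at a point where it is attained
   the triangle inequality is an equality, which forces c_n / c_0 = (c_1 / c_0)^n. So T agrees with
   T_{alpha,beta} on polynomials, and Taylor expansion extends this to Hol(D). *)

theory Submission
  imports Defs
begin

section \<open>Maximum modulus on closed discs\<close>

definition max_mod :: "real \<Rightarrow> (complex \<Rightarrow> complex) \<Rightarrow> real" where
  "max_mod r f = (SUP z\<in>cball 0 r. cmod (f z))"

text \<open>Compactness of the disc turns the supremum into a maximum, so \<open>max_mod\<close> is
  the value at an actual point and bounds the function. The later arguments work at such a maximum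
  point.\<close>

lemma max_mod_attained:
  assumes "continuous_on (cball 0 r) f" "0 \<le> r"
  obtains w where "w \<in> cball 0 r" "cmod (f w) = max_mod r f"
    "\<And>z. z \<in> cball 0 r \<Longrightarrow> cmod (f z) \<le> max_mod r f"
proof -
  have "\<exists>w\<in>cball 0 r. \<forall>z\<in>cball 0 r. cmod (f z) \<le> cmod (f w)"
    using assms by (intro continuous_attains_sup continuous_on_norm) auto
  then obtain w where w: "w \<in> cball 0 r" "\<And>z. z \<in> cball 0 r \<Longrightarrow> cmod (f z) \<le> cmod (f w)"
    by blast
  have "max_mod r f = cmod (f w)"
    unfolding max_mod_def using w by (intro cSup_eq_maximum) auto
  with w that show ?thesis by metis
qed

lemma max_mod_eqI:
  assumes "w \<in> cball 0 r" "cmod (f w) = m" "\<And>z. z \<in> cball 0 r \<Longrightarrow> cmod (f z) \<le> m"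
  shows "max_mod r f = m"
  unfolding max_mod_def using assms by (intro cSup_eq_maximum) auto

lemma Hol_disc_continuous_on_cball:
  assumes "f \<in> Hol unit_disc" "r < 1"
  shows "continuous_on (cball 0 r) f"
proof (rule continuous_on_subset)
  show "continuous_on unit_disc f"
    using assms(1) by (intro holomorphic_on_imp_continuous_on) (simp add: Hol_def)
  show "cball 0 r \<subseteq> unit_disc" using assms(2) by auto
qed

lemma norm_le_max_mod:
  assumes "f \<in> Hol unit_disc" "r < 1" "z \<in> cball 0 r"
  shows "cmod (f z) \<le> max_mod r f"
proof -
  have "0 \<le> r" using assms(3) norm_ge_zero[of z] by (simp del: norm_ge_zero)
  then show ?thesis
    using max_mod_attained[OF Hol_disc_continuous_on_cball[OF assms(1,2)]] assms(3) by metis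
qed

section \<open>Closure properties of \<open>Hol\<close> and finite sums under a linear
  operator\<close>

lemma zero_off_in_Hol:
  assumes "f holomorphic_on \<Omega>"
  shows "zero_off \<Omega> f \<in> Hol \<Omega>"
  using assms holomorphic_cong[of \<Omega> \<Omega> "zero_off \<Omega> f" f] by (simp add: Hol_def zero_off_def)

lemma zero_off_Hol: "f \<in> Hol \<Omega> \<Longrightarrow> zero_off \<Omega> f = f"
  by (auto simp: Hol_def zero_off_def)

lemma Hol_zero: "(\<lambda>z. 0) \<in> Hol \<Omega>"
  by (simp add: Hol_def)

lemma Hol_add: "f \<in> Hol \<Omega> \<Longrightarrow> g \<in> Hol \<Omega> \<Longrightarrow> (\<lambda>z. f z + g z) \<in> Hol \<Omega>"
  by (auto simp: Hol_def intro: holomorphic_intros)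

lemma Hol_cmult: "f \<in> Hol \<Omega> \<Longrightarrow> (\<lambda>z. c * f z) \<in> Hol \<Omega>"
  by (auto simp: Hol_def intro: holomorphic_intros)

lemma Hol_sum:
  fixes n :: nat
  assumes "\<And>k. f k \<in> Hol \<Omega>"
  shows "(\<lambda>z. \<Sum>k<n. a k * f k z) \<in> Hol \<Omega>"
  by (induction n) (simp_all add: Hol_zero Hol_add Hol_cmult assms)

lemma linear_operator_on_add:
  "linear_operator_on X T \<Longrightarrow> f \<in> X \<Longrightarrow> g \<in> X \<Longrightarrow>
    T (\<lambda>z. f z + g z) = (\<lambda>z. T f z + T g z)"
  by (simp add: linear_operator_on_def)

lemma linear_operator_on_cmult:
  "linear_operator_on X T \<Longrightarrow> f \<in> X \<Longrightarrow> T (\<lambda>z. c * f z) = (\<lambda>z. c * T f z)"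
  by (simp add: linear_operator_on_def)

lemma linear_operator_on_sum:
  fixes n :: nat
  assumes T: "linear_operator_on (Hol \<Omega>) T" and f: "\<And>k. f k \<in> Hol \<Omega>"
  shows "T (\<lambda>z. \<Sum>k<n. a k * f k z) = (\<lambda>z. \<Sum>k<n. a k * T (f k) z)"
proof (induction n)
  case 0
  \<comment> \<open>Homogeneity with scalar 0 shows that \<open>T\<close> sends the zero function to
    zero.\<close>
  have "T (\<lambda>z. 0 * 0) = (\<lambda>z. 0 * T (\<lambda>z. 0) z)"
    by (rule linear_operator_on_cmult[OF T Hol_zero])
  then show ?case by simp
next
  case (Suc n)
  have "T (\<lambda>z. (\<Sum>k<n. a k * f k z) + a n * f n z)
      = (\<lambda>z. T (\<lambda>z. \<Sum>k<n. a k * f k z) z + T (\<lambda>z. a n * f n z) z)"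
    by (intro linear_operator_on_add[OF T] Hol_sum Hol_cmult f)
  moreover have "T (\<lambda>z. a n * f n z) = (\<lambda>z. a n * T (f n) z)"
    by (rule linear_operator_on_cmult[OF T f])
  ultimately show ?case using Suc by simp
qed

section \<open>Schwarz-type rigidity of monomials\<close>

text \<open>An iterated Schwarz lemma: each induction step divides out one zero at the origin and
  lowers the exponent in the bound by one.\<close>

lemma holomorphic_factor_power:
  assumes "g holomorphic_on unit_disc" "\<And>z. z \<in> unit_disc \<Longrightarrow> cmod (g z) \<le> cmod z ^ n"
  shows "\<exists>h. h holomorphic_on unit_disc \<and>
           (\<forall>z\<in>unit_disc. g z = z ^ n * h z \<and> cmod (h z) \<le> 1)"
  using assms
proof (induction n arbitrary: g)
  case 0
  then show ?case by (intro exI[of _ g]) auto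
next
  case (Suc n)
  have "g 0 = 0" using Suc.prems(2)[of 0] by simp
  then obtain k where k: "k holomorphic_on unit_disc" "\<And>z. norm z < 1 \<Longrightarrow> g z = z * k z"
    using Schwarz3[OF Suc.prems(1)] by metis
  have nz: "cmod (k z) \<le> cmod z ^ n" if "z \<in> unit_disc - {0}" for z
    using Suc.prems(2)[of z] k(2)[of z] that by (simp add: norm_mult)
  \<comment> \<open>Dividing by \<open>z\<close> loses the bound at the origin; it is recovered as a
    limit from the punctured disc. For \<open>n = 0\<close> the bound there is 1, since
    \<open>0 ^ 0 = 1\<close>.\<close>
  have "cmod (k 0) \<le> cmod 0 ^ n"
  proof (rule tendsto_le)
    show "((\<lambda>z. cmod (k z)) \<longlongrightarrow> cmod (k 0)) (at 0)"
      using holomorphic_on_imp_continuous_on[OF k(1)]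
      by (intro tendsto_norm) (simp add: continuous_on_eq_continuous_at isCont_def)
    show "((\<lambda>z. cmod z ^ n) \<longlongrightarrow> cmod 0 ^ n) (at 0)"
      by (intro tendsto_intros)
    show "\<forall>\<^sub>F z in at 0. cmod (k z) \<le> cmod z ^ n"
      using nz by (intro eventually_at_in_open[of unit_disc, THEN eventually_mono]) auto
  qed simp
  with nz have "cmod (k z) \<le> cmod z ^ n" if "z \<in> unit_disc" for z
    using that by (cases "z = 0") auto
  from Suc.IH[OF k(1) this] obtain h where "h holomorphic_on unit_disc"
    "\<And>z. z \<in> unit_disc \<Longrightarrow> k z = z ^ n * h z \<and> cmod (h z) \<le> 1" by blast
  with k(2) show ?case
    by (intro exI[of _ h]) (simp add: mult_ac)
qed

text \<open>The quotient of \<open>g\<close> by \<open>z ^ n\<close> has modulus at most 1 and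
  reaches 1 at an interior point, so the maximum modulus principle makes it constant.\<close>

lemma max_mod_power_imp_monomial:
  assumes g: "g \<in> Hol unit_disc"
    and M: "\<And>r. 0 \<le> r \<Longrightarrow> r < 1 \<Longrightarrow> max_mod r g = r ^ n"
  shows "\<exists>c. cmod c = 1 \<and> (\<forall>z\<in>unit_disc. g z = c * z ^ n)"
proof -
  have hol: "g holomorphic_on unit_disc" using g by (simp add: Hol_def)
  have "cmod (g z) \<le> cmod z ^ n" if "z \<in> unit_disc" for z
    using norm_le_max_mod[OF g, of "cmod z" z] M[of "cmod z"] that by simp
  from holomorphic_factor_power[OF hol this] obtain h where h: "h holomorphic_on unit_disc"
    "\<And>z. z \<in> unit_disc \<Longrightarrow> g z = z ^ n * h z" "\<And>z. z \<in> unit_disc \<Longrightarrow> cmod (h z) \<le> 1"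
    by auto
  \<comment> \<open>The radius 1/2 is a sample from the open interval (0,1): below 1 it keeps
    \<open>w\<close> inside the disc, and positivity allows cancelling
    \<open>(1/2) ^ n\<close>.\<close>
  obtain w where w: "w \<in> cball 0 (1/2)" "cmod (g w) = (1/2) ^ n"
    using max_mod_attained[OF Hol_disc_continuous_on_cball[OF g], of "1/2"] M[of "1/2"] by auto
  then have wD: "w \<in> unit_disc" by simp
  have "(1/2) ^ n = cmod w ^ n * cmod (h w)"
    using w(2) h(2)[OF wD] by (simp add: norm_mult norm_power)
  also have "\<dots> \<le> (1/2) ^ n * cmod (h w)"
    using w(1) by (intro mult_right_mono power_mono) auto
  finally have "1 \<le> cmod (h w)" by simp
  with h(3)[OF wD] have hw: "cmod (h w) = 1" by simp
  have "h constant_on unit_disc"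
    by (rule maximum_modulus_principle[OF h(1), of unit_disc w]) (use wD hw h(3) in auto)
  then obtain c where "\<And>z. z \<in> unit_disc \<Longrightarrow> h z = c"
    unfolding constant_on_def by blast
  with h(2) hw wD show ?thesis by (intro exI[of _ c]) auto
qed

section \<open>Equality in the triangle inequality\<close>

lemma norm_add_eq_imp_collinear:
  fixes a b c :: complex
  assumes "cmod a = 1" "cmod b \<le> r" "cmod c \<le> s" "cmod (a + b + c) = 1 + r + s"
  shows "b = of_real r * a" "c = of_real s * a"
proof -
  have 1: "cmod (a + b + c) \<le> cmod (a + b) + cmod c"
    "cmod (a + b + c) \<le> cmod (a + c) + cmod b"
    using norm_triangle_ineq[of "a + b" c] norm_triangle_ineq[of "a + c" b]
    by (simp_all add: add_ac)
  have 2: "cmod (a + b) \<le> cmod a + cmod b" "cmod (a + c) \<le> cmod a + cmod c"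
    by (rule norm_triangle_ineq)+
  \<comment> \<open>Either grouping of the three terms gives a chain of bounds from
    \<open>1 + r + s\<close> back to itself, so every inequality in it is tight.\<close>
  have n: "cmod b = r" "cmod c = s" "cmod (a + b) = cmod a + cmod b"
    "cmod (a + c) = cmod a + cmod c"
    using 1 2 assms by linarith+
  show "b = of_real r * a"
    using norm_triangle_eq[THEN iffD1, OF n(3)] n(1) assms(1) by (simp add: scaleR_conv_of_real)
  show "c = of_real s * a"
    using norm_triangle_eq[THEN iffD1, OF n(4)] n(2) assms(1) by (simp add: scaleR_conv_of_real)
qed

section \<open>Taylor approximation and monomials\<close>

lemma Hol_disc_uniform_limit_Taylor:
  assumes "f holomorphic_on unit_disc" "0 \<le> r" "r < 1"
  obtains a where
    "uniform_limit (cball 0 r) (\<lambda>n z. \<Sum>k<n. a k * z ^ k) f sequentially"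
proof -
  define a where "a k = (deriv ^^ k) f 0 / fact k" for k
  have sums: "(\<lambda>k. a k * z ^ k) sums f z" if "z \<in> unit_disc" for z
    using holomorphic_power_series[OF assms(1) that] by (simp add: a_def)
  \<comment> \<open>Summability at every real point of (0,1) bounds the radius of convergence below
    by 1, and a power series converges uniformly on each closed disc of smaller radius.\<close>
  have "1 \<le> conv_radius a"
  proof (rule conv_radius_geI_ex')
    fix x :: real assume "0 < x" "ereal x < 1"
    then have "complex_of_real x \<in> unit_disc" by simp
    then show "summable (\<lambda>n. a n * of_real x ^ n)" using sums sums_summable by blast
  qed
  moreover have "ereal r < 1" using assms by simp
  ultimately have "ereal r < conv_radius a" by (rule less_le_trans[rotated])
  from powser_uniform_limit[OF this, of 0]
  have "uniform_limit (cball 0 r) (\<lambda>n z. \<Sum>k<n. a k * z ^ k) (\<lambda>z. \<Sum>k. a k * z ^ k) sequentially"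
    by simp
  moreover have "(\<Sum>k. a k * z ^ k) = f z" if "z \<in> cball 0 r" for z
    using sums[of z] that assms by (simp add: sums_iff)
  ultimately have "uniform_limit (cball 0 r) (\<lambda>n z. \<Sum>k<n. a k * z ^ k) f sequentially"
    using uniform_limit_cong'[OF refl, of "cball 0 r" "\<lambda>z. \<Sum>k. a k * z ^ k" f] by blast
  then show ?thesis by (rule that)
qed

text \<open>Cutting off outside the disc makes the power an element of \<open>Hol unit_disc\<close>,
  where \<open>T\<close> is controlled.\<close>

definition monomial :: "nat \<Rightarrow> complex \<Rightarrow> complex" where
  "monomial n = zero_off unit_disc (\<lambda>z. z ^ n)"

lemma monomial_in_Hol: "monomial n \<in> Hol unit_disc"
  unfolding monomial_def by (intro zero_off_in_Hol holomorphic_intros)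

lemma monomial_disc: "cmod z < 1 \<Longrightarrow> monomial n z = z ^ n"
  by (simp add: monomial_def zero_off_def)

section \<open>Linear operators on the disc that preserve the maximum modulus\<close>

lemma max_mod_preserving_eq_T_op:
  assumes T: "linear_operator_on (Hol unit_disc) T"
    and M: "\<And>f r. f \<in> Hol unit_disc \<Longrightarrow> 0 \<le> r \<Longrightarrow> r < 1 \<Longrightarrow> max_mod r (T f) = max_mod r f"
  shows "\<exists>\<alpha>\<in>unit_circle. \<exists>\<beta>\<in>unit_circle. \<forall>f\<in>Hol unit_disc. T f = T_op \<alpha> \<beta> f"
proof -
  have T_Hol: "T f \<in> Hol unit_disc" if "f \<in> Hol unit_disc" for f
    using T that unfolding linear_operator_on_def by blast
  have "max_mod r (monomial n) = r ^ n" if "0 \<le> r" "r < 1" for r n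
    by (rule max_mod_eqI[of "of_real r"]) (use that in \<open>auto simp: monomial_disc norm_power power_mono\<close>)
  then have "\<exists>c. cmod c = 1 \<and> (\<forall>z\<in>unit_disc. T (monomial n) z = c * z ^ n)" for n
    by (intro max_mod_power_imp_monomial T_Hol monomial_in_Hol) (simp add: M monomial_in_Hol)
  then obtain c where c: "\<And>n. cmod (c n) = 1"
    "\<And>n z. z \<in> unit_disc \<Longrightarrow> T (monomial n) z = c n * z ^ n"
    by metis
  \<comment> \<open>The target formula sends 1 to \<alpha> and \<open>z\<close> to
    \<alpha>\<beta>\<open>z\<close>, so \<open>c 0\<close> and \<open>c 1\<close> force both
    constants.\<close>
  define \<alpha> where "\<alpha> = c 0"
  define \<beta> where "\<beta> = c 1 / c 0"
  have \<alpha>: "cmod \<alpha> = 1" and \<beta>: "cmod \<beta> = 1"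
    by (simp_all add: \<alpha>_def \<beta>_def norm_divide c)
  have c_eq: "c n = \<alpha> * \<beta> ^ n" for n
  proof -
    \<comment> \<open>The exponents 0, 1, \<open>n\<close> are indexed so that
      \<open>1 + z + z ^ n\<close> has the shape required by \<open>linear_operator_on_sum\<close>.
      They may coincide, so \<open>n = 0\<close> and \<open>n = 1\<close> need no separate
      case.\<close>
    define j :: "nat \<Rightarrow> nat" where "j i = (if i = 0 then 0 else if i = 1 then 1 else n)" for i
    define f where "f = (\<lambda>z. \<Sum>i<3. 1 * monomial (j i) z)"
    have f: "f \<in> Hol unit_disc" unfolding f_def by (intro Hol_sum monomial_in_Hol)
    have fz: "f z = 1 + z + z ^ n" if "cmod z < 1" for z
      using that by (simp add: f_def j_def monomial_disc eval_nat_numeral)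
    \<comment> \<open>All three terms are positive at the real point 1/2, so the triangle bound is
      attained there.\<close>
    have "max_mod (1/2) f = 1 + 1/2 + (1/2) ^ n"
    proof (rule max_mod_eqI[of "of_real (1/2)"])
      show "cmod (f (of_real (1/2))) = 1 + 1/2 + (1/2) ^ n"
      proof -
        have "f (of_real (1/2)) = of_real (1 + 1/2 + (1/2) ^ n)"
          by (subst fz) simp_all
        then show ?thesis by (simp only: norm_of_real) simp
      qed
      fix z :: complex assume z: "z \<in> cball 0 (1/2)"
      have "cmod (1 + z + z ^ n) \<le> 1 + cmod z + cmod z ^ n"
        by (metis norm_triangle_mono norm_triangle_ineq norm_one norm_power order_refl)
      also have "\<dots> \<le> 1 + 1/2 + (1/2) ^ n"
        using z by (intro add_mono power_mono) auto
      finally show "cmod (f z) \<le> 1 + 1/2 + (1/2) ^ n"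
        using z fz[of z] by simp
    qed simp
    then have "max_mod (1/2) (T f) = 1 + 1/2 + (1/2) ^ n"
      using M[OF f, of "1/2"] by simp
    then obtain w where w: "w \<in> cball 0 (1/2)" "cmod (T f w) = 1 + 1/2 + (1/2) ^ n"
      using max_mod_attained[OF Hol_disc_continuous_on_cball[OF T_Hol[OF f]], of "1/2"] by auto
    have "T f w = c 0 + c 1 * w + c n * w ^ n"
      unfolding f_def linear_operator_on_sum[OF T monomial_in_Hol]
      using w(1) by (simp add: j_def c(2) eval_nat_numeral)
    moreover have "cmod (c 1 * w) \<le> 1/2" "cmod (c n * w ^ n) \<le> (1/2) ^ n"
      using w(1) power_mono[of "cmod w" "1/2" n] by (simp_all add: norm_mult norm_power c)
    \<comment> \<open>At the maximum point \<open>w\<close> of \<open>T f\<close> the terms have the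
      largest possible total modulus, so the last two are positive multiples of
      \<open>c 0\<close>.\<close>
    ultimately have eq: "c 1 * w = of_real (1/2) * c 0" "c n * w ^ n = of_real ((1/2) ^ n) * c 0"
      using norm_add_eq_imp_collinear[OF c(1)[of 0], of "c 1 * w" "1/2" "c n * w ^ n" "(1/2) ^ n"]
        w(2) by simp_all
    have nz: "c 0 \<noteq> 0" "c 1 \<noteq> 0" using c(1)[of 0] c(1)[of 1] by auto
    have bw: "\<beta> * w = of_real (1/2)" using eq(1) nz by (simp add: \<beta>_def field_simps)
    then have "w \<noteq> 0" by auto
    \<comment> \<open>Both sides equal \<alpha>\<open>* (1/2) ^ n\<close>, because
      \<beta>\<open>* w\<close> is 1/2; cancelling \<open>w ^ n\<close> then gives
      \<open>c n\<close>.\<close>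
    have "c n * w ^ n = \<alpha> * \<beta> ^ n * w ^ n"
      using eq(2) unfolding \<alpha>_def mult.assoc power_mult_distrib[symmetric] bw by simp
    then show ?thesis using \<open>w \<noteq> 0\<close> by simp
  qed
  have "T f = T_op \<alpha> \<beta> f" if f: "f \<in> Hol unit_disc" for f
  proof
    fix z
    show "T f z = T_op \<alpha> \<beta> f z"
    proof (cases "z \<in> unit_disc")
      case False
      then show ?thesis using T_Hol[OF f] by (auto simp: Hol_def T_op_def zero_off_def)
    next
      case z: True
      \<comment> \<open>The closed disc with \<open>z\<close> on its boundary also contains
        \<beta>\<open>z\<close>, as \<beta> has modulus 1.\<close>
      define r where "r = cmod z"
      have r: "0 \<le> r" "r < 1" and zr: "z \<in> cball 0 r" "\<beta> * z \<in> cball 0 r"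
        using z \<beta> by (simp_all add: r_def norm_mult)
      obtain a where a: "uniform_limit (cball 0 r) (\<lambda>n z. \<Sum>k<n. a k * z ^ k) f sequentially"
        using Hol_disc_uniform_limit_Taylor[OF _ r] f unfolding Hol_def by blast
      define p where "p n = (\<lambda>z. \<Sum>k<n. a k * monomial k z)" for n
      have p: "p n \<in> Hol unit_disc" for n
        unfolding p_def by (intro Hol_sum monomial_in_Hol)
      have pz: "p n x = (\<Sum>k<n. a k * x ^ k)" if "x \<in> cball 0 r" for x n
        using that r by (simp add: p_def monomial_disc)
      have Tp: "T (p n) z = \<alpha> * p n (\<beta> * z)" for n
        unfolding pz[OF zr(2)] unfolding p_def linear_operator_on_sum[OF T monomial_in_Hol]
        using z by (simp add: c c_eq power_mult_distrib sum_distrib_left algebra_simps)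
      \<comment> \<open>Continuity of \<open>T\<close> along the Taylor polynomials: preservation of
        \<open>max_mod r\<close>, applied to the difference \<open>p n - f\<close>, transfers
        uniform convergence from \<open>p n\<close> to \<open>T (p n)\<close>.\<close>
      have "(\<lambda>n. T (p n) z) \<longlonglongrightarrow> T f z"
      proof (rule LIMSEQ_I)
        fix e :: real assume e: "0 < e"
        \<comment> \<open>A supremum of values below \<open>e/2\<close> is only known to be at most
          \<open>e/2\<close>; halving keeps the final inequality strict.\<close>
        from uniform_limitD[OF a, of "e/2"] e obtain N where
          N: "\<And>n x. n \<ge> N \<Longrightarrow> x \<in> cball 0 r \<Longrightarrow> dist (\<Sum>k<n. a k * x ^ k) (f x) < e/2"
          unfolding eventually_sequentially by (metis half_gt_zero)
        have "cmod (T (p n) z - T f z) < e" if n: "n \<ge> N" for n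
        proof -
          \<comment> \<open>The difference is written as a sum with a scalar multiple by -1, the two
            operations for which linearity is stated.\<close>
          define q where "q = (\<lambda>z. p n z + (-1) * f z)"
          have q: "q \<in> Hol unit_disc" unfolding q_def by (intro Hol_add Hol_cmult p f)
          have "T q = (\<lambda>z. T (p n) z + T (\<lambda>z. (-1) * f z) z)"
            unfolding q_def by (intro linear_operator_on_add[OF T] Hol_cmult p f)
          moreover have "T (\<lambda>z. (-1) * f z) = (\<lambda>z. (-1) * T f z)"
            by (rule linear_operator_on_cmult[OF T f])
          ultimately have "cmod (T (p n) z - T f z) = cmod (T q z)" by simp
          also have "\<dots> \<le> max_mod r q"
            using norm_le_max_mod[OF T_Hol[OF q] r(2) zr(1)] M[OF q r] by simp
          also have "\<dots> \<le> e/2"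
            unfolding max_mod_def
          proof (rule cSUP_least)
            show "cball (0::complex) r \<noteq> {}" using r by simp
            fix x :: complex assume x: "x \<in> cball 0 r"
            show "cmod (q x) \<le> e/2"
              using N[OF n x] pz[OF x, of n] by (simp add: q_def dist_norm)
          qed
          finally show ?thesis using e by simp
        qed
        then show "\<exists>N. \<forall>n\<ge>N. cmod (T (p n) z - T f z) < e" by blast
      qed
      moreover have "(\<lambda>n. p n (\<beta> * z)) \<longlonglongrightarrow> f (\<beta> * z)"
        using tendsto_uniform_limitI[OF a zr(2)] by (simp add: pz[OF zr(2)])
      then have "(\<lambda>n. T (p n) z) \<longlonglongrightarrow> \<alpha> * f (\<beta> * z)"
        unfolding Tp by (intro tendsto_intros)
      ultimately have "T f z = \<alpha> * f (\<beta> * z)" by (rule LIMSEQ_unique)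
      then show ?thesis using z by (simp add: T_op_def zero_off_def)
    qed
  qed
  then show ?thesis using \<alpha> \<beta> by (intro bexI[of _ \<alpha>] bexI[of _ \<beta>]) auto
qed

section \<open>Transfer to the half-plane by the Cayley transform\<close>

lemma C_cayley_in_Hol:
  assumes "F \<in> Hol right_half_plane"
  shows "C_cayley F \<in> Hol unit_disc"
  unfolding C_cayley_def
proof (intro zero_off_in_Hol holomorphic_on_compose_gen)
  show "cayley holomorphic_on unit_disc"
    unfolding cayley_def by (intro holomorphic_intros) auto
  show "F holomorphic_on right_half_plane" using assms by (simp add: Hol_def)
  show "cayley ` unit_disc \<subseteq> right_half_plane" using Re_cayley_pos by blast
qed

lemma C_cayley_inv_in_Hol:
  assumes "f \<in> Hol unit_disc"
  shows "C_cayley_inv f \<in> Hol right_half_plane"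
  unfolding C_cayley_inv_def
proof (intro zero_off_in_Hol holomorphic_on_compose_gen)
  have "(\<lambda>w. (w - 1) / (w + 1)) holomorphic_on right_half_plane"
    by (intro holomorphic_intros) (auto simp: right_half_plane_def complex_eq_iff)
  then show "cayley_inv holomorphic_on right_half_plane"
    by (rule holomorphic_transform) (simp add: cayley_inv_eq)
  show "f holomorphic_on unit_disc" using assms by (simp add: Hol_def)
  show "cayley_inv ` right_half_plane \<subseteq> unit_disc"
    using cayley_inverse_mem(1) cayley_inv_eq by (auto simp del: mem_ball)
qed

lemma C_cayley_inv_C_cayley:
  assumes "F \<in> Hol right_half_plane"
  shows "C_cayley_inv (C_cayley F) = F"
proof -
  have "C_cayley_inv (C_cayley F) = zero_off right_half_plane F"
    using cayley_inverse_mem cayley_inv_eq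
    by (auto simp: C_cayley_inv_def C_cayley_def zero_off_def fun_eq_iff simp del: mem_ball)
  then show ?thesis using zero_off_Hol[OF assms] by simp
qed

lemma C_cayley_C_cayley_inv:
  assumes "f \<in> Hol unit_disc"
  shows "C_cayley (C_cayley_inv f) = f"
proof -
  have "C_cayley (C_cayley_inv f) = zero_off unit_disc f"
    using Re_cayley_pos bij_betw_cayley
    by (auto simp: C_cayley_inv_def C_cayley_def zero_off_def fun_eq_iff bij_betw_def inv_into_f_f
        simp del: mem_ball)
  then show ?thesis using zero_off_Hol[OF assms] by simp
qed

text \<open>For \<open>r < 1\<close> the closed disc lies in \<open>unit_disc\<close>, so the cutoff
  has no effect and the supremum is only reparametrized by \<open>cayley\<close>.\<close>

lemma max_mod_C_cayley:
  assumes "r < 1"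
  shows "max_mod r (C_cayley F) = (SUP z\<in>L r. cmod (F z))"
proof -
  have "cmod (C_cayley F z) = cmod (F (cayley z))" if "z \<in> cball 0 r" for z
    using that assms by (auto simp: C_cayley_def zero_off_def)
  then show ?thesis
    by (simp add: max_mod_def L_def image_image cong: image_cong_simp)
qed

theorem mainTheorem2:
  fixes V :: "(complex \<Rightarrow> complex) \<Rightarrow> (complex \<Rightarrow> complex)"
  assumes "linear_operator_on (Hol right_half_plane) V"
    and "\<And>F r. F \<in> Hol right_half_plane \<Longrightarrow> 0 \<le> r \<Longrightarrow> r < 1 \<Longrightarrow>
           (SUP z\<in>L r. cmod (V F z)) = (SUP z\<in>L r. cmod (F z))"
  shows "\<exists>\<alpha>\<in>unit_circle. \<exists>\<beta>\<in>unit_circle.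
           \<forall>F\<in>Hol right_half_plane. V F = (C_cayley_inv \<circ> T_op \<alpha> \<beta> \<circ> C_cayley) F"
proof -
  \<comment> \<open>Conjugation carries the suprema over \<open>L r\<close> to suprema over
    \<open>cball 0 r\<close>, so the result on the disc applies to \<open>T\<close>.\<close>
  define T where "T = C_cayley \<circ> V \<circ> C_cayley_inv"
  have V_Hol: "V F \<in> Hol right_half_plane" if "F \<in> Hol right_half_plane" for F
    using assms(1) that unfolding linear_operator_on_def by blast
  have "linear_operator_on (Hol unit_disc) T"
    unfolding linear_operator_on_def
  proof (intro conjI ballI allI)
    fix f assume f: "f \<in> Hol unit_disc"
    show "T f \<in> Hol unit_disc"
      by (simp add: T_def C_cayley_in_Hol V_Hol C_cayley_inv_in_Hol f)
    fix g assume g: "g \<in> Hol unit_disc"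
    have "V (\<lambda>z. C_cayley_inv f z + C_cayley_inv g z)
        = (\<lambda>z. V (C_cayley_inv f) z + V (C_cayley_inv g) z)"
      by (intro linear_operator_on_add[OF assms(1)] C_cayley_inv_in_Hol f g)
    moreover have "C_cayley_inv (\<lambda>z. f z + g z) = (\<lambda>z. C_cayley_inv f z + C_cayley_inv g z)"
      by (auto simp: C_cayley_inv_def zero_off_def)
    ultimately show "T (\<lambda>z. f z + g z) = (\<lambda>z. T f z + T g z)"
      by (auto simp: T_def C_cayley_def zero_off_def)
  next
    fix c f assume f: "f \<in> Hol unit_disc"
    have "V (\<lambda>z. c * C_cayley_inv f z) = (\<lambda>z. c * V (C_cayley_inv f) z)"
      by (intro linear_operator_on_cmult[OF assms(1)] C_cayley_inv_in_Hol f)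
    moreover have "C_cayley_inv (\<lambda>z. c * f z) = (\<lambda>z. c * C_cayley_inv f z)"
      by (auto simp: C_cayley_inv_def zero_off_def)
    ultimately show "T (\<lambda>z. c * f z) = (\<lambda>z. c * T f z)"
      by (auto simp: T_def C_cayley_def zero_off_def)
  qed
  moreover have "max_mod r (T f) = max_mod r f" if "f \<in> Hol unit_disc" "0 \<le> r" "r < 1" for f r
  proof -
    have "max_mod r (T f) = max_mod r (C_cayley (C_cayley_inv f))"
      using assms(2)[OF C_cayley_inv_in_Hol[OF that(1)] that(2,3)] that(3)
      by (simp add: T_def max_mod_C_cayley)
    then show ?thesis by (simp add: C_cayley_C_cayley_inv that)
  qed
  ultimately obtain \<alpha> \<beta> where \<alpha>\<beta>: "\<alpha> \<in> unit_circle" "\<beta> \<in> unit_circle"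
    and T: "\<And>f. f \<in> Hol unit_disc \<Longrightarrow> T f = T_op \<alpha> \<beta> f"
    using max_mod_preserving_eq_T_op by blast
  \<comment> \<open>Applied to \<open>C_cayley F\<close>, the formula for \<open>T\<close> describes
    \<open>C_cayley (V F)\<close>; applying \<open>C_cayley_inv\<close> recovers
    \<open>V F\<close>.\<close>
  have "V F = (C_cayley_inv \<circ> T_op \<alpha> \<beta> \<circ> C_cayley) F" if F: "F \<in> Hol right_half_plane" for F
    using T[OF C_cayley_in_Hol[OF F], symmetric]
    by (simp add: T_def C_cayley_inv_C_cayley V_Hol F)
  with \<alpha>\<beta> show ?thesis by blast
qed

end
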